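(* Let $d$ be a positive integer, and let $w_1\ge w_2\ge\ldots$ be a monotone decreasing infinite sequence of positive numbers such that $$\limsup_{n\rightarrow\infty}\frac{w_1+w_2+\ldots+w_n}{\log(1/w_n)}> 0.$$ Then any sequence of slabs $S_1,S_2,\ldots\subset\mathbb{R}^d$, where $S_i$ has width $w_i$ for $i=1,2,\ldots$, permits a translative covering of $\mathbb{R}^d$.
   Context: A slab of width $w>0$ in $\mathbb{R}^d$ is the closed set of points lying between two parallel hyperplanes at distance $w$ from each other, i.e. a set of the form $\{\mathbf{x}\in\mathbb{R}^d: b\le\langle\mathbf{v},\mathbf{x}\rangle\le b+w\}$ with $\mathbf{v}$ a unit vector and $b\in\mathbb{R}$. A sequence of slabs $S_1,S_2,\ldots$ permits a translative covering of a set $C\subseteq\mathbb{R}^d$ if there are translates $S_i'$ of $S_i$ ($i=1,2,\ldots$) such that $\bigcup_i S_i'\supseteq C$. Here $\log$ is the natural logarithm. "Monotone decreasing" is meant in the non-strict sense. *)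

theory Defs
  imports "HOL-Analysis.Analysis"
begin

definition is_slab :: "real \<Rightarrow> 'a::euclidean_space set \<Rightarrow> bool" where
  "is_slab w S \<longleftrightarrow>
     0 < w \<and> (\<exists>v b. norm v = 1 \<and> S = {x. b \<le> v \<bullet> x \<and> v \<bullet> x \<le> b + w})"

definition permits_translative_covering ::
    "(nat \<Rightarrow> 'a::euclidean_space set) \<Rightarrow> 'a set \<Rightarrow> bool" where
  "permits_translative_covering S C \<longleftrightarrow>
     (\<exists>t :: nat \<Rightarrow> 'a. C \<subseteq> (\<Union>i. (\<lambda>x. t i + x) ` S i))"

text \<open>
  Sequences are indexed from 0, so \<open>w n\<close> and \<open>\<Sum>i\<le>n. w i\<close> are the (n+1)-st width and partial sum.
  The quotient is taken in \<^typ>\<open>ereal\<close>, where a positive number divided by 0 is \<open>\<infinity>\<close>; this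
  concerns only the terms with \<open>w n = 1\<close>, and affects the limit superior only if \<open>w\<close> is
  eventually constantly 1.
\<close>
definition width_ratio :: "(nat \<Rightarrow> real) \<Rightarrow> nat \<Rightarrow> ereal" where
  "width_ratio w n = ereal (\<Sum>i\<le>n. w i) / ereal (ln (1 / w n))"

end

theory Submission
  imports Defs
begin

text \<open>
  It is enough to find a fixed cube \<open>Q\<close> such that every tail of the sequence has a finite initial
  block permitting a covering of \<open>Q\<close>: consecutive blocks then cover countably many translates
  of \<open>Q\<close>. If the widths do not tend to 0, one slab
  covers a small \<open>Q\<close>. Otherwise, to cover \<open>Q\<close>, take a grid of mesh proportional to the smallest width \<open>w n\<close>
  of the block and place the slabs greedily at half their width. By the pigeonhole principle, a slab
  of width \<open>u\<close> can be placed so that it hits a proportion at least \<open>u / (3 R)\<close> of the grid points that are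
  left, where \<open>R\<close> is proportional to the size of \<open>Q\<close>. The number of points left at the end is thus
  at most \<open>O((1 / w n) ^ d) * exp (- (\<Sum> w i) / (6 R))\<close>, which is less than 1 if \<open>Q\<close> is small and
  \<open>\<Sum> w i \<ge> \<epsilon> * ln (1 / w n)\<close>. Restoring the full widths covers the points between the grid points.
\<close>

section \<open>Greedy placement of intervals against a finite set of points\<close>

text \<open>Cutting \<open>[-R, R]\<close> into consecutive pieces of length \<open>u\<close> takes
  at most \<open>2 * R / u + 1\<close> pieces, and \<open>u \<le> R\<close> makes this at most
  \<open>3 * R / u\<close>. The piece containing the most values of \<open>f\<close> therefore
  catches a share of at least \<open>u / (3 * R)\<close> of \<open>P\<close>.\<close>

lemma interval_pigeonhole:
  fixes f :: "'b \<Rightarrow> real"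
  assumes "finite P" "0 < u" "u \<le> R" "\<And>p. p \<in> P \<Longrightarrow> \<bar>f p\<bar> \<le> R"
  shows "\<exists>b. real (card {p \<in> P. f p \<notin> {b..b + u}}) \<le> (1 - u / (3 * R)) * real (card P)"
proof (cases "P = {}")
  case False
  define g where "g p = \<lfloor>(f p + R) / u\<rfloor>" for p
  define N where "N = \<lfloor>2 * R / u\<rfloor>"
  have R: "R > 0" using assms by linarith
  have g: "g ` P \<subseteq> {0..N}"
  proof
    fix y assume "y \<in> g ` P"
    then obtain p where p: "p \<in> P" "y = g p" by blast
    have "0 \<le> f p + R" "f p + R \<le> 2 * R" using assms(4)[OF p(1)] by linarith+
    then show "y \<in> {0..N}"
      unfolding p(2) g_def N_def using \<open>0 < u\<close> by (auto intro!: floor_mono divide_right_mono)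
  qed
  have fin: "finite (g ` P)" using assms(1) by simp
  have N0: "0 \<le> N" using R \<open>0 < u\<close> by (simp add: N_def)
  have "real (card (g ` P)) \<le> real (card {0..N})"
    using card_mono[OF _ g] by simp
  also have "\<dots> = of_int N + 1" using N0 by simp
  also have "\<dots> \<le> 2 * R / u + 1" unfolding N_def by linarith
  also have "\<dots> \<le> 3 * R / u" using assms(2,3) by (simp add: field_simps)
  finally have cg: "real (card (g ` P)) \<le> 3 * R / u" .
  have "\<exists>y\<in>g ` P. real (card P) * (u / (3 * R)) \<le> real (card {p \<in> P. g p = y})"
  proof (rule ccontr)
    assume "\<not> ?thesis"
    then have *: "\<And>y. y \<in> g ` P \<Longrightarrow> real (card {p \<in> P. g p = y}) < real (card P) * (u / (3 * R))"
      by force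
    have "card P = (\<Sum>y\<in>g ` P. card {p \<in> P. g p = y})"
      using sum.image_gen[OF assms(1), of "\<lambda>_. 1::nat" g] by simp
    then have "real (card P) = (\<Sum>y\<in>g ` P. real (card {p \<in> P. g p = y}))"
      by (metis of_nat_sum)
    also have "\<dots> < (\<Sum>y\<in>g ` P. real (card P) * (u / (3 * R)))"
      using False fin * by (intro sum_strict_mono) auto
    also have "\<dots> = real (card (g ` P)) * (real (card P) * (u / (3 * R)))" by simp
    also have "\<dots> \<le> 3 * R / u * (real (card P) * (u / (3 * R)))"
      using cg R \<open>0 < u\<close> by (intro mult_right_mono) auto
    also have "\<dots> = real (card P)" using R \<open>0 < u\<close> by simp
    finally show False by simp
  qed
  then obtain y where y: "real (card P) * (u / (3 * R)) \<le> real (card {p \<in> P. g p = y})" by blast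
  \<comment> \<open>The left end of the piece numbered \<open>y\<close>, since \<open>g\<close>
    numbers the pieces from 0 starting at \<open>-R\<close>.\<close>
  define b where "b = of_int y * u - R"
  have "{p \<in> P. g p = y} \<subseteq> P - {p \<in> P. f p \<notin> {b..b + u}}"
  proof
    fix p assume "p \<in> {p \<in> P. g p = y}"
    then have p: "p \<in> P" "of_int y \<le> (f p + R) / u" "(f p + R) / u < of_int y + 1"
      unfolding g_def by (auto simp: floor_eq_iff)
    then have "of_int y * u \<le> f p + R" "f p + R < of_int y * u + u"
      using \<open>0 < u\<close> by (auto simp: field_simps)
    then show "p \<in> P - {p \<in> P. f p \<notin> {b..b + u}}" using p unfolding b_def by auto
  qed
  then have "card {p \<in> P. g p = y} \<le> card (P - {p \<in> P. f p \<notin> {b..b + u}})"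
    using assms(1) by (intro card_mono) auto
  also have "\<dots> = card P - card {p \<in> P. f p \<notin> {b..b + u}}"
    using assms(1) by (intro card_Diff_subset) auto
  finally have "real (card {p \<in> P. g p = y}) \<le> real (card P) - real (card {p \<in> P. f p \<notin> {b..b + u}})"
    using card_mono[OF assms(1), of "{p \<in> P. f p \<notin> {b..b + u}}"] by auto
  then show ?thesis using y by (intro exI[of _ b]) (simp add: algebra_simps)
qed simp

text \<open>Each new interval is chosen by pigeonhole for the points missed so far. The surviving
  shares multiply, and \<open>1 - x \<le> exp (- x)\<close> turns their product into the exponential
  of a sum.\<close>

lemma greedy_intervals:
  fixes f :: "'i \<Rightarrow> 'b \<Rightarrow> real"
  assumes "finite I" "finite P"
    and "\<And>i. i \<in> I \<Longrightarrow> 0 < u i \<and> u i \<le> R"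
    and "\<And>i p. i \<in> I \<Longrightarrow> p \<in> P \<Longrightarrow> \<bar>f i p\<bar> \<le> R"
  shows "\<exists>b. real (card {p \<in> P. \<forall>i\<in>I. f i p \<notin> {b i..b i + u i}})
            \<le> real (card P) * exp (- (\<Sum>i\<in>I. u i) / (3 * R))"
  using assms(1,3,4)
proof (induction I rule: finite_induct)
  case (insert j I)
  then obtain b where b: "real (card {p \<in> P. \<forall>i\<in>I. f i p \<notin> {b i..b i + u i}})
            \<le> real (card P) * exp (- (\<Sum>i\<in>I. u i) / (3 * R))" by auto
  let ?Q = "{p \<in> P. \<forall>i\<in>I. f i p \<notin> {b i..b i + u i}}"
  obtain c where c: "real (card {p \<in> ?Q. f j p \<notin> {c..c + u j}}) \<le> (1 - u j / (3 * R)) * real (card ?Q)"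
    using interval_pigeonhole[of ?Q "u j" R "f j"] insert.prems assms(2) by auto
  have "{p \<in> P. \<forall>i\<in>insert j I. f i p \<notin> {(b(j := c)) i..(b(j := c)) i + u i}}
      = {p \<in> ?Q. f j p \<notin> {c..c + u j}}"
    using insert.hyps by (auto simp: fun_upd_def)
  then have "real (card {p \<in> P. \<forall>i\<in>insert j I. f i p \<notin> {(b(j := c)) i..(b(j := c)) i + u i}})
      \<le> (1 - u j / (3 * R)) * real (card ?Q)" using c by (simp only:)
  also have "\<dots> \<le> exp (- u j / (3 * R)) * real (card ?Q)"
    using exp_ge_add_one_self[of "- u j / (3 * R)"] by (intro mult_right_mono) auto
  also have "\<dots> \<le> exp (- u j / (3 * R)) * (real (card P) * exp (- (\<Sum>i\<in>I. u i) / (3 * R)))"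
    using b by (intro mult_left_mono) auto
  also have "\<dots> = real (card P) * exp (- (\<Sum>i\<in>insert j I. u i) / (3 * R))"
    using insert.hyps by (simp add: exp_add[symmetric] add_divide_distrib diff_divide_distrib)
  finally show ?case by blast
qed simp

section \<open>Grids, and covering a cube by finitely many slabs\<close>

lemma norm_sum_Basis_le:
  fixes g :: "'a::euclidean_space \<Rightarrow> real"
  assumes "\<And>b. b \<in> Basis \<Longrightarrow> \<bar>g b\<bar> \<le> K"
  shows "norm (\<Sum>b\<in>Basis. g b *\<^sub>R b :: 'a) \<le> real DIM('a) * K"
  by (rule sum_norm_bound) (simp add: assms)

text \<open>The points are integer multiples of \<open>h\<close> in each coordinate, and rounding
  the coordinates of \<open>x\<close> down gives a nearby one. The assumption
  \<open>h \<le> r\<close> absorbs the rounding terms into the constants 5 and 2; the factor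
  \<open>DIM('a)\<close> comes from bounding norms by sums over coordinates.\<close>

lemma cube_grid:
  assumes "0 < h" "h \<le> r"
  shows "\<exists>P :: 'a::euclidean_space set. finite P
    \<and> real (card P) \<le> (5 * r / h) ^ DIM('a)
    \<and> (\<forall>p\<in>P. norm p \<le> real DIM('a) * (2 * r))
    \<and> (\<forall>x. (\<forall>b\<in>Basis. \<bar>x \<bullet> b\<bar> \<le> r) \<longrightarrow> (\<exists>p\<in>P. norm (x - p) \<le> real DIM('a) * h))"
proof -
  define N where "N = \<lceil>r / h\<rceil>"
  define K where "K = PiE (Basis :: 'a set) (\<lambda>_. {-N..N})"
  define G :: "('a \<Rightarrow> int) \<Rightarrow> 'a" where "G k = (\<Sum>b\<in>Basis. (h * of_int (k b)) *\<^sub>R b)" for k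
  have r: "r > 0" using assms by linarith
  have N0: "N \<ge> 0" unfolding N_def using assms r by (simp add: le_ceiling_iff less_le_trans[of _ 0])
  have Nle: "of_int N \<le> r / h + 1" unfolding N_def by linarith
  have finK: "finite K" unfolding K_def by (intro finite_PiE) auto
  have "card (G ` K) \<le> card K" using finK by (rule card_image_le)
  also have "card K = nat (2 * N + 1) ^ DIM('a)"
    unfolding K_def by (simp add: card_PiE)
  finally have "real (card (G ` K)) \<le> real (nat (2 * N + 1)) ^ DIM('a)"
    by (metis of_nat_le_iff of_nat_power)
  also have "\<dots> \<le> (5 * r / h) ^ DIM('a)"
  proof (rule power_mono)
    have "real (nat (2 * N + 1)) = 2 * of_int N + 1" using N0 by simp
    also have "\<dots> \<le> 2 * (r / h) + 3" using Nle by simp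
    also have "\<dots> \<le> 5 * r / h" using assms by (simp add: field_simps)
    finally show "real (nat (2 * N + 1)) \<le> 5 * r / h" .
  qed simp
  finally have card: "real (card (G ` K)) \<le> (5 * r / h) ^ DIM('a)" .
  have bound: "norm (G k) \<le> real DIM('a) * (2 * r)" if "k \<in> K" for k
    unfolding G_def
  proof (rule norm_sum_Basis_le)
    fix b :: 'a assume "b \<in> Basis"
    then have "k b \<in> {-N..N}" using that unfolding K_def by auto
    then have "\<bar>of_int (k b)\<bar> \<le> (of_int N :: real)" by (auto simp flip: of_int_abs)
    then have "h * \<bar>of_int (k b)\<bar> \<le> h * (r / h + 1)" using Nle assms by (intro mult_left_mono) auto
    also have "\<dots> \<le> 2 * r" using assms by (simp add: field_simps)
    finally show "\<bar>h * of_int (k b)\<bar> \<le> 2 * r" using assms by (simp add: abs_mult)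
  qed
  have net: "\<exists>p\<in>G ` K. norm (x - p) \<le> real DIM('a) * h" if x: "\<forall>b\<in>Basis. \<bar>x \<bullet> b\<bar> \<le> r" for x
  proof -
    define k where "k = (\<lambda>b\<in>Basis. \<lfloor>x \<bullet> b / h\<rfloor>)"
    have "k \<in> K" unfolding K_def k_def
    proof (rule restrict_PiE_iff[THEN iffD2], intro ballI)
      fix b :: 'a assume "b \<in> Basis"
      then have "- (r / h) \<le> x \<bullet> b / h" "x \<bullet> b / h \<le> r / h"
        using x assms by (auto simp: field_simps abs_le_iff)
      then show "\<lfloor>x \<bullet> b / h\<rfloor> \<in> {-N..N}"
        unfolding N_def atLeastAtMost_iff le_floor_iff by linarith
    qed
    have "x - G k = (\<Sum>b\<in>Basis. (x \<bullet> b) *\<^sub>R b) - (\<Sum>b\<in>Basis. (h * of_int (k b)) *\<^sub>R b)"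
      unfolding G_def by (simp add: euclidean_representation)
    also have "\<dots> = (\<Sum>b\<in>Basis. (x \<bullet> b - h * of_int (k b)) *\<^sub>R b)"
      by (simp add: sum_subtractf scaleR_left_diff_distrib)
    also have "norm \<dots> \<le> real DIM('a) * h"
    proof (rule norm_sum_Basis_le)
      fix b :: 'a assume b: "b \<in> Basis"
      have "of_int \<lfloor>x \<bullet> b / h\<rfloor> \<le> x \<bullet> b / h" "x \<bullet> b / h < of_int \<lfloor>x \<bullet> b / h\<rfloor> + 1" by linarith+
      then have "of_int \<lfloor>x \<bullet> b / h\<rfloor> * h \<le> x \<bullet> b" "x \<bullet> b < (of_int \<lfloor>x \<bullet> b / h\<rfloor> + 1) * h"
        using assms(1) by (simp_all only: pos_le_divide_eq pos_divide_less_eq)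
      then show "\<bar>x \<bullet> b - h * of_int (k b)\<bar> \<le> h" using b by (simp add: k_def algebra_simps)
    qed
    finally show ?thesis using \<open>k \<in> K\<close> by blast
  qed
  show ?thesis using finK card bound net by (intro exI[of _ "G ` K"]) auto
qed

lemma cube_covering:
  fixes v :: "'i \<Rightarrow> 'a::euclidean_space"
  assumes "finite I" "0 < a" "a \<le> r"
    and v: "\<And>i. i \<in> I \<Longrightarrow> norm (v i) = 1"
    and w: "\<And>i. i \<in> I \<Longrightarrow> a \<le> w i \<and> w i \<le> r"
    and small: "(20 * real DIM('a) * r / a) ^ DIM('a) * exp (- (\<Sum>i\<in>I. w i) / (12 * real DIM('a) * r)) < 1"
  shows "\<exists>b. \<forall>x. (\<forall>e\<in>Basis. \<bar>x \<bullet> e\<bar> \<le> r) \<longrightarrow> (\<exists>i\<in>I. v i \<bullet> x \<in> {b i..b i + w i})"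
proof -
  let ?d = "real DIM('a)"
  have d: "?d \<ge> 1" using DIM_positive[where 'a='a] by linarith
  \<comment> \<open>Chosen so that every point of the cube lies within
    \<open>DIM('a) * h = a / 4\<close> of a grid point, a quarter of the lower bound on the
    widths.\<close>
  define h where "h = a / (4 * ?d)"
  have "1 \<le> 4 * ?d" using d by linarith
  then have "h \<le> a" using divide_left_mono[of 1 "4 * ?d" a] assms(2) unfolding h_def by simp
  then have h: "0 < h" "h \<le> r" using assms(2,3) d by (auto simp: h_def)
  obtain P :: "'a set" where P: "finite P" "real (card P) \<le> (5 * r / h) ^ DIM('a)"
      "\<And>p. p \<in> P \<Longrightarrow> norm p \<le> ?d * (2 * r)"
      "\<And>x. \<forall>e\<in>Basis. \<bar>x \<bullet> e\<bar> \<le> r \<Longrightarrow> \<exists>p\<in>P. norm (x - p) \<le> ?d * h"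
    using cube_grid[OF h, where 'a='a] by blast
  define R where "R = ?d * (2 * r)"
  have rR: "r \<le> R" using d assms(2,3) mult_mono[of 1 ?d r "2 * r"] by (simp add: R_def)
  obtain b where b: "real (card {p \<in> P. \<forall>i\<in>I. v i \<bullet> p \<notin> {b i..b i + w i / 2}})
      \<le> real (card P) * exp (- (\<Sum>i\<in>I. w i / 2) / (3 * R))"
  proof (atomize_elim, rule greedy_intervals)
    show "0 < w i / 2 \<and> w i / 2 \<le> R" if "i \<in> I" for i
      using w[OF that] assms(2) rR by auto
    show "\<bar>v i \<bullet> p\<bar> \<le> R" if "i \<in> I" "p \<in> P" for i p
      using Cauchy_Schwarz_ineq2[of "v i" p] v[OF that(1)] P(3)[OF that(2)] by (simp add: R_def)
  qed (use assms P in auto)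
  have "5 * r / h = 20 * ?d * r / a" using d assms(2) by (simp add: h_def field_simps)
  moreover have "- (\<Sum>i\<in>I. w i / 2) / (3 * R) = - (\<Sum>i\<in>I. w i) / (12 * ?d * r)"
    using d assms(2,3) by (simp add: R_def sum_divide_distrib[symmetric] field_simps)
  ultimately have "real (card {p \<in> P. \<forall>i\<in>I. v i \<bullet> p \<notin> {b i..b i + w i / 2}}) < 1"
    using b small P(2)
    by (smt (verit, best) exp_ge_zero mult_right_mono)
  \<comment> \<open>A cardinality below 1 is 0, so the half-width slabs catch every grid
    point.\<close>
  then have empty: "{p \<in> P. \<forall>i\<in>I. v i \<bullet> p \<notin> {b i..b i + w i / 2}} = {}"
    using P(1) by simp
  show ?thesis
  \<comment> \<open>Lowering the left end by \<open>w i / 4\<close> centres the half-width interval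
    in the full one. The margin \<open>w i / 4\<close> on either side bridges the distance to the
    grid point.\<close>
  proof (intro exI[of _ "\<lambda>i. b i - w i / 4"] allI impI)
    fix x :: 'a assume "\<forall>e\<in>Basis. \<bar>x \<bullet> e\<bar> \<le> r"
    then obtain p where p: "p \<in> P" "norm (x - p) \<le> ?d * h" using P(4) by blast
    then obtain i where i: "i \<in> I" "v i \<bullet> p \<in> {b i..b i + w i / 2}" using empty by blast
    have "\<bar>v i \<bullet> (x - p)\<bar> \<le> ?d * h"
      using Cauchy_Schwarz_ineq2[of "v i" "x - p"] v[OF i(1)] p(2) by simp
    also have "\<dots> = a / 4" using d by (simp add: h_def)
    also have "\<dots> \<le> w i / 4" using w[OF i(1)] by simp
    finally have "\<bar>v i \<bullet> x - v i \<bullet> p\<bar> \<le> w i / 4" by (simp add: inner_diff_right)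
    then have "v i \<bullet> x \<in> {b i - w i / 4..b i - w i / 4 + w i}"
      using i(2) unfolding atLeastAtMost_iff by linarith
    then show "\<exists>i\<in>I. v i \<bullet> x \<in> {b i - w i / 4..b i - w i / 4 + w i}" using i(1) by blast
  qed
qed

section \<open>From covering a cube to covering the space\<close>

text \<open>Moving along the unit normal shifts \<open>v \<bullet> x\<close> by exactly the length
  of the move, so choosing translates amounts to choosing lower ends.\<close>

lemma slab_translate:
  fixes v :: "'a::real_inner"
  assumes "norm v = 1"
  shows "(\<lambda>x. (b' - b) *\<^sub>R v + x) ` {x. b \<le> v \<bullet> x \<and> v \<bullet> x \<le> b + w} = {x. v \<bullet> x \<in> {b'..b' + w}}"
proof -
  have v: "v \<bullet> v = 1" using assms by (simp add: dot_square_norm)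
  show ?thesis
  proof (intro equalityI subsetI)
    fix x assume "x \<in> {x. v \<bullet> x \<in> {b'..b' + w}}"
    then show "x \<in> (\<lambda>x. (b' - b) *\<^sub>R v + x) ` {x. b \<le> v \<bullet> x \<and> v \<bullet> x \<le> b + w}"
      using v by (intro image_eqI[of _ _ "x - (b' - b) *\<^sub>R v"]) (auto simp: inner_diff_right)
  qed (use v in \<open>auto simp: inner_add_right\<close>)
qed

text \<open>The sets are covered one after another, each by a block of slabs starting where the
  previous block ended, so no slab is used twice.\<close>

lemma permits_covering_blocks:
  fixes S :: "nat \<Rightarrow> 'a::euclidean_space set" and C :: "nat \<Rightarrow> 'a set"
  assumes "\<And>m k. \<exists>n t. C k \<subseteq> (\<Union>i\<in>{m..<n}. (\<lambda>x. t i + x) ` S i)"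
  shows "permits_translative_covering S (\<Union>k. C k)"
proof -
  define cov where "cov m k n t \<longleftrightarrow> C k \<subseteq> (\<Union>i\<in>{m..<n}. (\<lambda>x. t i + x) ` S i)" for m k n t
  have "\<exists>n t. cov m k n t" for m k using assms unfolding cov_def .
  then obtain n T where "\<And>m k. cov m k (n m k) (T m k)" by metis
  then have nT: "\<And>m k. C k \<subseteq> (\<Union>i\<in>{m..<n m k}. (\<lambda>x. T m k i + x) ` S i)"
    unfolding cov_def .
  \<comment> \<open>\<open>M k\<close> is the start of block \<open>k\<close>. The maximum keeps
    \<open>M\<close> monotone even when the given end lies before the start and the block is
    empty.\<close>
  define M where "M = rec_nat 0 (\<lambda>k m. max m (n m k))"
  have M_Suc: "M (Suc k) = max (M k) (n (M k) k)" for k by (simp add: M_def)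
  have mono: "M i \<le> M j" if "i \<le> j" for i j
    using lift_Suc_mono_le[of M, OF _ that] M_Suc by simp
  \<comment> \<open>The least such \<open>k\<close> is the number of the block containing
    \<open>i\<close>. An index lying in no block gets an arbitrary translate, which does no
    harm.\<close>
  define t where "t i = (let k = LEAST k. i < M (Suc k) in T (M k) k i)" for i
  have "(\<Union>k. C k) \<subseteq> (\<Union>i. (\<lambda>x. t i + x) ` S i)"
  proof
    fix x assume "x \<in> (\<Union>k. C k)"
    then obtain k i where i: "i \<in> {M k..<n (M k) k}" "x \<in> (\<lambda>x. T (M k) k i + x) ` S i"
      using nT by blast
    have "(LEAST k. i < M (Suc k)) = k"
    proof (rule Least_equality)
      show "i < M (Suc k)" using i by (simp add: M_Suc)
      show "k \<le> l" if "i < M (Suc l)" for l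
        using that i mono[of "Suc l" k] by (metis atLeastLessThan_iff leD le_less_trans not_less_eq_eq)
    qed
    then have "t i = T (M k) k i" by (simp add: t_def Let_def)
    then show "x \<in> (\<Union>i. (\<lambda>x. t i + x) ` S i)" using i(2) by (intro UN_I[of i]) simp_all
  qed
  then show ?thesis unfolding permits_translative_covering_def by blast
qed

text \<open>Copies of the cube centred at a countable dense set cover the space, and a covering of
  the cube can be translated along with it.\<close>

lemma permits_covering_UNIV:
  fixes S :: "nat \<Rightarrow> 'a::euclidean_space set"
  assumes "0 < r"
    and "\<And>m. \<exists>n t. {x. \<forall>e\<in>Basis. \<bar>x \<bullet> e\<bar> \<le> r} \<subseteq> (\<Union>i\<in>{m..<n}. (\<lambda>x. t i + x) ` S i)"
  shows "permits_translative_covering S UNIV"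
proof -
  let ?Q = "{x::'a. \<forall>e\<in>Basis. \<bar>x \<bullet> e\<bar> \<le> r}"
  obtain D :: "'a set" where D: "countable D" "\<And>X. open X \<Longrightarrow> X \<noteq> {} \<Longrightarrow> \<exists>d\<in>D. d \<in> X"
    using countable_dense_exists[where 'a='a] by blast
  then have "D \<noteq> {}" by blast
  define c where "c = from_nat_into D"
  have "permits_translative_covering S (\<Union>k. (\<lambda>x. c k + x) ` ?Q)"
  proof (rule permits_covering_blocks)
    fix m k
    obtain n t where "?Q \<subseteq> (\<Union>i\<in>{m..<n}. (\<lambda>x. t i + x) ` S i)" using assms(2) by blast
    then have "(\<lambda>x. c k + x) ` ?Q \<subseteq> (\<Union>i\<in>{m..<n}. (\<lambda>x. (c k + t i) + x) ` S i)"
      by (force simp: add.assoc)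
    then show "\<exists>n t. (\<lambda>x. c k + x) ` ?Q \<subseteq> (\<Union>i\<in>{m..<n}. (\<lambda>x. t i + x) ` S i)"
      by (intro exI[of _ n] exI[of _ "\<lambda>i. c k + t i"])
  qed
  moreover have "x \<in> (\<Union>k. (\<lambda>x. c k + x) ` ?Q)" for x :: 'a
  proof -
    obtain d where d: "d \<in> D" "d \<in> ball x r" using D(2)[of "ball x r"] assms(1) by auto
    then obtain k where k: "c k = d"
      using from_nat_into_surj[OF D(1)] unfolding c_def by blast
    have "\<bar>(x - d) \<bullet> e\<bar> \<le> r" if "e \<in> Basis" for e
      using Basis_le_norm[OF that, of "x - d"] d(2) by (simp add: dist_norm)
    then show ?thesis using k by (intro UN_I[of k] image_eqI[of _ _ "x - d"]) auto
  qed
  then have "(\<Union>k. (\<lambda>x. c k + x) ` ?Q) = UNIV" by blast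
  ultimately show ?thesis by simp
qed

section \<open>Estimates on the widths\<close>

text \<open>The choice of \<open>r\<close> makes the exponential at most \<open>a ^ (D + 1)\<close>.
  This outweighs the factor \<open>a ^ D\<close> in the denominator with one power of
  \<open>a\<close> to spare, leaving \<open>A ^ D * a\<close>.\<close>

lemma cube_covering_threshold:
  fixes A d r \<epsilon> a s :: real
  assumes "0 < r" "0 < A" "0 < d" "0 < a"
    and r: "12 * d * r * (real D + 1) = \<epsilon>"
    and a: "A ^ D * a < 1" and s: "\<epsilon> * ln (1 / a) \<le> s"
  shows "(A / a) ^ D * exp (- s / (12 * d * r)) < 1"
proof -
  have "(real D + 1) * ln (1 / a) \<le> s / (12 * d * r)"
    using s assms(1,3) unfolding r[symmetric] by (simp add: pos_le_divide_eq algebra_simps)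
  then have "exp (- s / (12 * d * r)) \<le> exp ((real D + 1) * ln a)"
    using assms(4) by (simp add: ln_div)
  also have "\<dots> = a ^ Suc D"
    using assms(4) by (metis add.commute exp_ln exp_of_nat_mult of_nat_Suc)
  finally have "(A / a) ^ D * exp (- s / (12 * d * r)) \<le> (A / a) ^ D * a ^ Suc D"
    using assms by (intro mult_left_mono) auto
  also have "\<dots> = A ^ D * a" using assms(4) by (simp add: power_divide)
  finally show ?thesis using a by simp
qed

text \<open>Dropping the first \<open>m\<close> widths loses a fixed amount, which is at most half
  of the logarithmic bound once \<open>w n\<close> is small; hence the limsup condition survives for
  tails, with one \<open>\<epsilon>\<close> for all \<open>m\<close>.\<close>

lemma width_blocks:
  assumes pos: "\<And>i. 0 < w i" and lim: "w \<longlonglongrightarrow> 0" and sup: "limsup (width_ratio w) > 0"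
  shows "\<exists>\<epsilon>>0. \<forall>m. \<forall>\<eta>>0. \<exists>n\<ge>m. w n < \<eta> \<and> \<epsilon> * ln (1 / w n) \<le> (\<Sum>i\<in>{m..n}. w i)"
proof -
  obtain \<epsilon> where \<epsilon>: "0 < ereal \<epsilon>" "ereal \<epsilon> < limsup (width_ratio w)"
    using ereal_dense2[OF sup] by auto
  have "\<exists>n\<ge>m. w n < \<eta> \<and> \<epsilon> / 2 * ln (1 / w n) \<le> (\<Sum>i\<in>{m..n}. w i)" if \<eta>: "\<eta> > 0" for m \<eta>
  proof -
    define W where "W = (\<Sum>i<m. w i)"
    \<comment> \<open>The bound 1 makes the logarithm positive, so the quotient in
      \<open>ereal\<close> can be cleared; the last entry gives
      \<open>W \<le> \<epsilon> / 2 * ln (1 / w n)\<close>.\<close>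
    define \<theta> where "\<theta> = Min {1, \<eta>, exp (- 2 * W / \<epsilon>)}"
    have \<theta>: "\<theta> > 0" "\<theta> \<le> 1" "\<theta> \<le> \<eta>" "\<theta> \<le> exp (- 2 * W / \<epsilon>)" using \<eta> by (auto simp: \<theta>_def)
    have "eventually (\<lambda>n. w n < \<theta>) sequentially" using order_tendstoD(2)[OF lim \<theta>(1)] .
    \<comment> \<open>Otherwise the ratio would eventually be at most \<open>\<epsilon>\<close>, and
      so would its limsup.\<close>
    moreover have "frequently (\<lambda>n. ereal \<epsilon> < width_ratio w n) sequentially"
      using Limsup_bounded[of "width_ratio w" "ereal \<epsilon>" sequentially] \<epsilon>(2)
      unfolding frequently_def not_less by (metis leD)
    ultimately have "frequently (\<lambda>n. (w n < \<theta> \<and> m \<le> n) \<and> ereal \<epsilon> < width_ratio w n) sequentially"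
      by (intro frequently_eventually_conj) (auto intro: eventually_conj eventually_ge_at_top)
    from frequently_ex[OF this] obtain n
      where n: "w n < \<theta>" "m \<le> n" "ereal \<epsilon> < width_ratio w n" by blast
    have ln: "ln (1 / w n) > 0" using n(1) \<theta> pos[of n] by simp
    have "\<epsilon> * ln (1 / w n) < (\<Sum>i\<le>n. w i)"
      using n(3) ln by (simp add: width_ratio_def field_simps)
    also have "\<dots> = W + (\<Sum>i\<in>{m..n}. w i)"
    proof -
      have "{..n} = {..<m} \<union> {m..n}" using n(2) by auto
      then show ?thesis unfolding W_def by (simp add: sum.union_disjoint ivl_disj_int)
    qed
    finally have *: "\<epsilon> * ln (1 / w n) < W + (\<Sum>i\<in>{m..n}. w i)" .
    have "w n \<le> exp (- 2 * W / \<epsilon>)" using n(1) \<theta>(4) by linarith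
    then have "ln (w n) \<le> - 2 * W / \<epsilon>" using pos[of n] by (metis ln_exp ln_mono)
    then have "W \<le> \<epsilon> / 2 * ln (1 / w n)" using \<epsilon>(1) pos[of n] by (simp add: ln_div field_simps)
    then show ?thesis using * n \<theta>(3) by (intro exI[of _ n]) auto
  qed
  then show ?thesis using \<epsilon>(1) by (intro exI[of _ "\<epsilon> / 2"]) auto
qed

section \<open>The two cases for the limit of the widths\<close>

theorem theorem1:
  fixes w :: "nat \<Rightarrow> real" and S :: "nat \<Rightarrow> (real ^ 'd) set"
  assumes "\<And>i. 0 < w i"
    and "decseq w"
    and "limsup (width_ratio w) > 0"
    and "\<And>i. is_slab (w i) (S i)"
  shows "permits_translative_covering S UNIV"
proof -
  let ?D = "DIM(real ^ 'd)"
  let ?Q = "\<lambda>r. {x :: real ^ 'd. \<forall>e\<in>Basis. \<bar>x \<bullet> e\<bar> \<le> r}"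
  have D: "real ?D > 0" by simp
  have "\<exists>v b. norm v = 1 \<and> S i = {x. b \<le> v \<bullet> x \<and> v \<bullet> x \<le> b + w i}" for i
    using assms(4) unfolding is_slab_def by blast
  then obtain v b where v: "\<And>i. norm (v i) = 1"
    and S: "\<And>i. S i = {x. b i \<le> v i \<bullet> x \<and> v i \<bullet> x \<le> b i + w i}" by metis
  have cover: "\<exists>t. C \<subseteq> (\<Union>i\<in>I. (\<lambda>x. t i + x) ` S i)"
    if "\<forall>x\<in>C. \<exists>i\<in>I. v i \<bullet> x \<in> {b' i..b' i + w i}" for C I b'
    using that slab_translate[OF v]
    by (intro exI[of _ "\<lambda>i. (b' i - b i) *\<^sub>R v i"]) (fastforce simp: S)
  obtain l where l: "w \<longlonglongrightarrow> l" "\<And>i. l \<le> w i"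
    using decseq_convergent[OF assms(2), of 0] assms(1) less_imp_le by metis
  have "l \<ge> 0" using LIMSEQ_le_const[OF l(1), of 0] assms(1) less_imp_le by blast
  then consider "l > 0" | "l = 0" by linarith
  then show ?thesis
  proof cases
    case 1
    \<comment> \<open>With this \<open>r\<close> the cube lies in the ball of radius
      \<open>l / 2\<close>, which a single slab of width at least \<open>l\<close> covers.\<close>
    define r where "r = l / (2 * real ?D)"
    have "r > 0" using 1 D by (simp add: r_def)
    then show ?thesis
    proof (rule permits_covering_UNIV)
      fix m
      have "v m \<bullet> x \<in> {- (l / 2)..- (l / 2) + w m}" if "x \<in> ?Q r" for x
      proof -
        have "norm x \<le> real ?D * r"
          using norm_sum_Basis_le[of "\<lambda>e. x \<bullet> e" r] that by (simp add: euclidean_representation)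
        also have "\<dots> = l / 2" using D by (simp add: r_def)
        finally have "\<bar>v m \<bullet> x\<bar> \<le> l / 2"
          using Cauchy_Schwarz_ineq2[of "v m" x] v[of m] by simp
        then show ?thesis using l(2)[of m] by auto
      qed
      then show "\<exists>n t. ?Q r \<subseteq> (\<Union>i\<in>{m..<n}. (\<lambda>x. t i + x) ` S i)"
        using cover[of "?Q r" "{m..<Suc m}" "\<lambda>_. - (l / 2)"]
        by (intro exI[of _ "Suc m"]) simp
    qed
  next
    case 2
    obtain \<epsilon> where \<epsilon>: "\<epsilon> > 0"
      "\<And>m \<eta>. \<eta> > 0 \<Longrightarrow> \<exists>n\<ge>m. w n < \<eta> \<and> \<epsilon> * ln (1 / w n) \<le> (\<Sum>i\<in>{m..n}. w i)"
      using width_blocks[of w] assms(1,3) l(1) 2 by metis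
    \<comment> \<open>Depends only on \<open>\<epsilon>\<close> and the dimension, so the same cube
      serves for every tail.\<close>
    define r where "r = \<epsilon> / (12 * real ?D * (real ?D + 1))"
    have r: "r > 0" "12 * real ?D * r * (real ?D + 1) = \<epsilon>"
      using \<epsilon>(1) D by (auto simp: r_def add_pos_pos)
    show ?thesis using r(1)
    proof (rule permits_covering_UNIV)
      fix m0
      have "eventually (\<lambda>n. w n < r) sequentially" using order_tendstoD(2)[OF l(1)] 2 r(1) by simp
      \<comment> \<open>The slabs from \<open>m0\<close> up to \<open>m\<close> may be too wide for
        the cube estimate and are left idle.\<close>
      then obtain m where m: "m \<ge> m0" "\<And>i. i \<ge> m \<Longrightarrow> w i < r"
        unfolding eventually_sequentially by (metis le_trans nle_le)
      \<comment> \<open>The constant in the grid count \<open>(A / w n) ^ DIM\<close>; the index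
        \<open>n\<close> is then taken so large that \<open>A ^ DIM * w n < 1\<close>.\<close>
      define A where "A = 20 * real ?D * r"
      have A: "A > 0" using D r by (simp add: A_def)
      obtain n where n: "n \<ge> m" "w n < 1 / A ^ ?D" "\<epsilon> * ln (1 / w n) \<le> (\<Sum>i\<in>{m..n}. w i)"
        using \<epsilon>(2)[of "1 / A ^ ?D" m] A by auto
      have wn: "A ^ ?D * w n < 1" using n(2) A by (simp add: field_simps)
      have "(A / w n) ^ ?D * exp (- (\<Sum>i\<in>{m..n}. w i) / (12 * real ?D * r)) < 1"
        by (rule cube_covering_threshold[OF r(1) A D assms(1) r(2) wn n(3)])
      \<comment> \<open>By monotonicity \<open>w n\<close> is the smallest width in the block, so it
        can serve as the lower bound that fixes the mesh.\<close>
      then have "\<exists>b'. \<forall>x. (\<forall>e\<in>Basis. \<bar>x \<bullet> e\<bar> \<le> r) \<longrightarrow> (\<exists>i\<in>{m..n}. v i \<bullet> x \<in> {b' i..b' i + w i})"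
        using assms(1) v less_imp_le[OF m(2)] n(1) decseqD[OF assms(2)]
        unfolding A_def by (intro cube_covering[of _ "w n"]) auto
      then obtain b' where "\<forall>x\<in>?Q r. \<exists>i\<in>{m..n}. v i \<bullet> x \<in> {b' i..b' i + w i}" by blast
      then have "\<forall>x\<in>?Q r. \<exists>i\<in>{m0..<Suc n}. v i \<bullet> x \<in> {b' i..b' i + w i}"
        using m(1) by fastforce
      then show "\<exists>n t. ?Q r \<subseteq> (\<Union>i\<in>{m0..<n}. (\<lambda>x. t i + x) ` S i)"
        by (intro exI[of _ "Suc n"] cover)
    qed
  qed
qed

end
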